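(* Let $\Omega$ be a bounded domain of $\mathbb{R}^N$, let $F\in \mathrm{C}^1(\mathbb{R})$, $f:=F'$, and let $L(u,z)=\tfrac12|z|^2+F(u)$ for $(u,z)\in\mathbb{R}\times\mathbb{R}^N$. Let $u\in \mathrm{C}^2(\Omega)\cap \mathrm{C}^1(\overline\Omega)$ be a real-valued non-trivial classical solution of Noether's equations $$\sum_{j=1}^N \frac{\partial}{\partial x_j}\left(\frac{\partial u}{\partial x_i}\frac{\partial u}{\partial x_j}-\delta_{ij}L(u,Du)\right)=0\quad\text{in }\Omega,\ i=1,\dots,N.$$ If the set $\mathrm{A}_0:=\{x\in\Omega:\ Du(x)=0\}$ has an interior point, then $f(u(x))=0$ for all $x$ in the interior of $\mathrm{A}_0$.
   Context: A domain is an open connected subset of $\mathbb{R}^N$. $\mathrm{C}^1(\overline\Omega)$ denotes the set of restrictions to $\Omega$ of continuously differentiable functions on $\mathbb{R}^N$. A function $u$ is called non-trivial if $Du$ is not identically $0$ in $\Omega$. $\delta_{ij}$ is the Kronecker delta. *)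

theory Defs
  imports "HOL-Analysis.Analysis"
begin

definition partial_deriv :: "'n \<Rightarrow> (real ^ 'n::finite \<Rightarrow> real) \<Rightarrow> real ^ 'n \<Rightarrow> real" where
  "partial_deriv i u x = deriv (\<lambda>t. u (x + t *\<^sub>R axis i 1)) 0"

definition grad :: "(real ^ 'n::finite \<Rightarrow> real) \<Rightarrow> real ^ 'n \<Rightarrow> real ^ 'n" where
  "grad u x = (\<chi> i. partial_deriv i u x)"

text \<open>The predicates below are meant for open sets \<open>S\<close>; the values of \<open>u\<close> outside \<open>S\<close>
  are then irrelevant.\<close>

definition C1_on :: "(real ^ 'n::finite) set \<Rightarrow> (real ^ 'n \<Rightarrow> real) \<Rightarrow> bool" where
  "C1_on S u \<longleftrightarrow> (\<forall>x\<in>S. u differentiable (at x)) \<and> continuous_on S (grad u)"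

definition C2_on :: "(real ^ 'n::finite) set \<Rightarrow> (real ^ 'n \<Rightarrow> real) \<Rightarrow> bool" where
  "C2_on S u \<longleftrightarrow> C1_on S u \<and> (\<forall>i. C1_on S (partial_deriv i u))"

text \<open>Membership in \<open>C\<^sup>1\<close> of the closure of \<open>S\<close>, understood as being the restriction to \<open>S\<close> of a
  continuously differentiable function on the whole space.\<close>

definition C1_closure :: "(real ^ 'n::finite) set \<Rightarrow> (real ^ 'n \<Rightarrow> real) \<Rightarrow> bool" where
  "C1_closure S u \<longleftrightarrow> (\<exists>v. C1_on UNIV v \<and> (\<forall>x\<in>S. u x = v x))"

definition lagrangian :: "(real \<Rightarrow> real) \<Rightarrow> real \<Rightarrow> real ^ 'n::finite \<Rightarrow> real" where
  "lagrangian F s z = 1 / 2 * (norm z)\<^sup>2 + F s"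

definition kronecker :: "'n \<Rightarrow> 'n \<Rightarrow> real" where
  "kronecker i j = (if i = j then 1 else 0)"

text \<open>Pointwise form of the equations. It has its intended (classical) meaning for \<open>u\<close> of class
  \<open>C\<^sup>2\<close> and \<open>F\<close> of class \<open>C\<^sup>1\<close>, when all the derivatives involved exist.\<close>

definition noether_equations ::
  "(real ^ 'n::finite) set \<Rightarrow> (real \<Rightarrow> real ^ 'n \<Rightarrow> real) \<Rightarrow> (real ^ 'n \<Rightarrow> real) \<Rightarrow> bool" where
  "noether_equations \<Omega> L u \<longleftrightarrow>
    (\<forall>i. \<forall>x\<in>\<Omega>.
      (\<Sum>j\<in>UNIV. partial_deriv j
        (\<lambda>y. partial_deriv i u y * partial_deriv j u y - kronecker i j * L (u y) (grad u y)) x) = 0)"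

end

theory Submission imports Defs begin

text \<open>Expanding the \<open>i\<close>-th Noether equation, multiplying it by the \<open>i\<close>-th partial derivative
  of \<open>u\<close> and summing over \<open>i\<close> cancels the remaining second derivatives by antisymmetry (so their
  symmetry is not needed), leaving \<open>|Du|\<^sup>2 (\<Delta>u - f(u)) = 0\<close>. A component \<open>G\<close> of the interior of
  the critical set has a frontier point \<open>p\<close> in \<open>\<Omega>\<close>, since \<open>u\<close> is non-trivial. There
  \<open>\<Delta>u - f(u)\<close> vanishes, because \<open>p\<close> is a limit of non-critical points; but on \<open>G\<close> this
  continuous function has the constant value \<open>- f(u)\<close>.\<close>

text \<open>Composing \<open>u\<close> with the line through \<open>x\<close> along
  \<open>axis i 1\<close> identifies \<open>partial_deriv i u x\<close> with the value of the
  derivative at that basis vector; linearity gives all other directions.\<close>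

lemma has_derivative_grad:
  assumes "u differentiable (at x)"
  shows "(u has_derivative (\<lambda>h. grad u x \<bullet> h)) (at x)"
proof -
  obtain D where D: "(u has_derivative D) (at x)"
    using assms by (auto simp: differentiable_def)
  have lin: "linear D"
    using D has_derivative_linear by blast
  have p: "partial_deriv i u x = D (axis i 1)" for i
  proof -
    have "((\<lambda>t. u (x + t *\<^sub>R axis i 1)) has_derivative (\<lambda>t. D (t *\<^sub>R axis i 1))) (at 0)"
      by (rule has_derivative_compose[of _ _ 0 UNIV u D]) (auto intro!: derivative_eq_intros simp: D)
    then have "((\<lambda>t. u (x + t *\<^sub>R axis i 1)) has_real_derivative D (axis i 1)) (at 0)"
      by (simp add: has_field_derivative_def linear_cmul[OF lin] mult.commute[of _ "D _"])
    then show ?thesis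
      unfolding partial_deriv_def by (rule DERIV_imp_deriv)
  qed
  have "D = (\<lambda>h. grad u x \<bullet> h)"
  proof
    fix h
    have "D h = D (\<Sum>i\<in>UNIV. (h $ i) *\<^sub>R axis i 1)"
      by (simp add: basis_expansion scalar_mult_eq_scaleR[symmetric])
    then show "D h = grad u x \<bullet> h"
      by (simp add: linear_sum[OF lin] linear_cmul[OF lin] inner_vec_def grad_def p mult.commute)
  qed
  with D show ?thesis by simp
qed

text \<open>\<open>deriv\<close> carries information only where a derivative exists; this form
  supplies that existence to the product, power and chain rules used below.\<close>

lemma has_partial_deriv:
  assumes "u differentiable (at x)"
  shows "((\<lambda>t. u (x + t *\<^sub>R axis i 1)) has_real_derivative partial_deriv i u x) (at 0)"
proof -
  have "((\<lambda>t. u (x + t *\<^sub>R axis i 1)) has_derivative (\<lambda>t. grad u x \<bullet> (t *\<^sub>R axis i 1))) (at 0)"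
    by (rule has_derivative_compose[of _ _ 0 UNIV u])
      (auto intro!: derivative_eq_intros simp: has_derivative_grad[OF assms])
  then show ?thesis
    by (simp add: has_field_derivative_def inner_axis grad_def mult.commute[of _ "partial_deriv i u x"])
qed

lemma grad_eq_0_iff: "grad u x = 0 \<longleftrightarrow> (\<forall>i. partial_deriv i u x = 0)"
  by (simp add: grad_def vec_eq_iff)

lemma noether_imp_pde:
  fixes u :: "real ^ 'n::finite \<Rightarrow> real"
  assumes F: "(F has_real_derivative f (u x)) (at (u x))"
    and u: "u differentiable (at x)"
    and Du: "\<And>i. partial_deriv i u differentiable (at x)"
    and eq: "\<And>i. (\<Sum>j\<in>UNIV. partial_deriv j (\<lambda>y. partial_deriv i u y * partial_deriv j u y
        - kronecker i j * lagrangian F (u y) (grad u y)) x) = 0"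
    and nz: "grad u x \<noteq> 0"
  shows "(\<Sum>i\<in>UNIV. partial_deriv i (partial_deriv i u) x) = f (u x)"
proof -
  let ?d = "\<lambda>i. partial_deriv i u x"
  let ?h = "\<lambda>i j. partial_deriv j (partial_deriv i u) x"
  have lag: "lagrangian F (u y) (grad u y) = 1 / 2 * (\<Sum>k\<in>UNIV. (partial_deriv k u y)\<^sup>2) + F (u y)" for y
    unfolding lagrangian_def power2_norm_eq_inner
    by (simp add: inner_vec_def grad_def power2_eq_square)
  have lagd: "((\<lambda>t. lagrangian F (u (x + t *\<^sub>R axis j 1)) (grad u (x + t *\<^sub>R axis j 1)))
      has_real_derivative (\<Sum>k\<in>UNIV. ?d k * ?h k j) + f (u x) * ?d j) (at 0)" for j
  proof -
    have "((\<lambda>t. F (u (x + t *\<^sub>R axis j 1))) has_real_derivative f (u x) * ?d j) (at 0)"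
      by (rule DERIV_chain2[of F]) (use F has_partial_deriv[OF u] in auto)
    moreover have "((\<lambda>t. \<Sum>k\<in>UNIV. (partial_deriv k u (x + t *\<^sub>R axis j 1))\<^sup>2)
        has_real_derivative (\<Sum>k\<in>UNIV. 2 * (?d k * ?h k j))) (at 0)"
      by (rule DERIV_sum) (use DERIV_power[OF has_partial_deriv[OF Du], where n = 2] in \<open>simp add: mult.commute\<close>)
    ultimately show ?thesis
      unfolding lag
      by (auto dest: DERIV_add[OF DERIV_cmult[of _ _ _ _ "1 / 2"]] simp: sum_distrib_left[symmetric])
  qed
  have term_eq: "partial_deriv j (\<lambda>y. partial_deriv i u y * partial_deriv j u y
        - kronecker i j * lagrangian F (u y) (grad u y)) x
      = ?h i j * ?d j + ?d i * ?h j j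
        - kronecker i j * ((\<Sum>k\<in>UNIV. ?d k * ?h k j) + f (u x) * ?d j)" for i j
    using DERIV_imp_deriv[OF DERIV_diff[OF
        DERIV_mult[OF has_partial_deriv[OF Du[of i]] has_partial_deriv[OF Du[of j]]]
        DERIV_cmult[OF lagd[of j], of "kronecker i j"]]]
    \<comment> \<open>The instantiated pattern unfolds only the outer derivative, taken of a
      difference, and leaves the partial derivatives of \<open>u\<close> folded.\<close>
    by (simp add: partial_deriv_def[of j "\<lambda>y. _ y - _ y"] mult_ac)
  define \<Delta> where "\<Delta> = (\<Sum>j\<in>UNIV. ?h j j)"
  \<comment> \<open>The Kronecker delta keeps only the term \<open>j = i\<close> of the Lagrangian
    part, so the right-hand side is the \<open>i\<close>-th derivative of the Lagrangian.\<close>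
  have row: "(\<Sum>j\<in>UNIV. ?h i j * ?d j) + ?d i * \<Delta>
      = (\<Sum>k\<in>UNIV. ?d k * ?h k i) + f (u x) * ?d i" for i
    using eq[of i] unfolding term_eq \<Delta>_def
    by (simp add: sum.distrib sum_subtractf sum_distrib_left kronecker_def if_distrib[of "\<lambda>c. c * _"] cong: if_cong)
  \<comment> \<open>Both sides are the quadratic form of the second derivatives evaluated at the
    gradient, with the two summation indices exchanged.\<close>
  have "(\<Sum>i\<in>UNIV. ?d i * (\<Sum>j\<in>UNIV. ?h i j * ?d j))
      = (\<Sum>i\<in>UNIV. ?d i * (\<Sum>k\<in>UNIV. ?d k * ?h k i))"
    unfolding sum_distrib_left by (subst sum.swap) (simp add: mult_ac)
  moreover have "(\<Sum>i\<in>UNIV. ?d i * ((\<Sum>j\<in>UNIV. ?h i j * ?d j) + ?d i * \<Delta>))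
      = (\<Sum>i\<in>UNIV. ?d i * ((\<Sum>k\<in>UNIV. ?d k * ?h k i) + f (u x) * ?d i))"
    by (simp only: row)
  ultimately have "\<Delta> * (\<Sum>i\<in>UNIV. (?d i)\<^sup>2) = f (u x) * (\<Sum>i\<in>UNIV. (?d i)\<^sup>2)"
    unfolding sum_distrib_left[of \<Delta>] sum_distrib_left[of "f (u x)"]
    by (simp only: distrib_left sum.distrib) (simp add: power2_eq_square mult_ac)
  moreover have "(\<Sum>i\<in>UNIV. (?d i)\<^sup>2) \<noteq> 0"
    using nz by (simp add: grad_eq_0_iff sum_nonneg_eq_0_iff)
  ultimately show ?thesis by (simp add: \<Delta>_def)
qed

text \<open>Used with \<open>partial_deriv i u\<close> in place of \<open>u\<close>: it makes the
  Laplacian vanish in the interior of the critical set.\<close>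

lemma partial_deriv_eq_0_of_open:
  assumes "open S" "x \<in> S" "\<And>y. y \<in> S \<Longrightarrow> u y = 0"
  shows "partial_deriv i u x = 0"
proof -
  have "(u has_derivative (\<lambda>h. 0)) (at x)"
    by (rule has_derivative_transform_within_open[OF _ assms(1,2), of "\<lambda>_. 0"]) (use assms(3) in auto)
  then have "((\<lambda>t. u (x + t *\<^sub>R axis i 1)) has_derivative (\<lambda>t. 0)) (at 0)"
    by (intro has_derivative_compose[of _ _ 0 UNIV u]) (auto intro!: derivative_eq_intros)
  then show ?thesis
    unfolding partial_deriv_def
    by (intro DERIV_imp_deriv) (simp add: has_field_derivative_def lambda_zero)
qed

theorem corollary1:
  fixes \<Omega> :: "(real ^ 'n::finite) set"
    and F f :: "real \<Rightarrow> real"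
    and u :: "real ^ 'n \<Rightarrow> real"
  assumes "open \<Omega>" and "connected \<Omega>" and "bounded \<Omega>"
    and "\<And>s. (F has_real_derivative f s) (at s)" and "continuous_on UNIV f"
    and "C2_on \<Omega> u" and "C1_closure \<Omega> u"
    and "\<exists>x\<in>\<Omega>. grad u x \<noteq> 0"
    and "noether_equations \<Omega> (lagrangian F) u"
    and "interior {x \<in> \<Omega>. grad u x = 0} \<noteq> {}"
  shows "\<forall>x \<in> interior {x \<in> \<Omega>. grad u x = 0}. f (u x) = 0"
proof
  fix x
  define I where "I = interior {x \<in> \<Omega>. grad u x = 0}"
  \<comment> \<open>\<open>I\<close> may be disconnected, and \<open>u\<close> may take different
    constant values on its components; hence the restriction to the component of
    \<open>x\<close>.\<close>
  define G where "G = connected_component_set I x"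
  define H where "H y = (\<Sum>i\<in>UNIV. partial_deriv i (partial_deriv i u) y) - f (u y)" for y
  assume "x \<in> interior {x \<in> \<Omega>. grad u x = 0}"
  then have "x \<in> I" by (simp add: I_def)
  have u: "u differentiable (at y)" and Du: "partial_deriv i u differentiable (at y)"
    if "y \<in> \<Omega>" for y i
    using \<open>C2_on \<Omega> u\<close> that by (auto simp: C2_on_def C1_on_def)
  have "open I" and I: "I \<subseteq> {x \<in> \<Omega>. grad u x = 0}"
    unfolding I_def by (simp_all add: interior_subset)
  have G: "x \<in> G" "G \<subseteq> I" "connected G" "open G"
    using \<open>x \<in> I\<close> \<open>open I\<close> unfolding G_def
    by (auto simp: connected_component_subset open_connected_component dest: connected_component_in)
  have contH: "continuous_on \<Omega> H"
  proof -
    have "continuous_on \<Omega> (partial_deriv i (partial_deriv i u))" for i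
    proof -
      have "continuous_on \<Omega> (\<lambda>y. grad (partial_deriv i u) y $ i)"
        using \<open>C2_on \<Omega> u\<close> by (intro continuous_intros) (auto simp: C2_on_def C1_on_def)
      then show ?thesis by (simp add: grad_def)
    qed
    moreover have "continuous_on \<Omega> u"
      using u by (intro differentiable_imp_continuous_on)
        (simp add: differentiable_at_imp_differentiable_on)
    ultimately show ?thesis
      unfolding H_def
      by (intro continuous_intros continuous_on_compose2[OF \<open>continuous_on UNIV f\<close>]) auto
  qed
  have H_noncritical: "H y = 0" if "y \<in> \<Omega>" "grad u y \<noteq> 0" for y
    unfolding H_def
    using noether_imp_pde[of F f u y] assms(4,9) u[OF that(1)] Du[OF that(1)] that
    by (simp add: noether_equations_def)
  have HG: "H y = - f (u x)" if "y \<in> G" for y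
  proof -
    have "(u has_derivative (\<lambda>h. 0)) (at z)" if "z \<in> G" for z
    proof -
      have "z \<in> \<Omega>" "grad u z = 0"
        using that G(2) I by auto
      then show ?thesis
        using has_derivative_grad[OF u[of z]] by simp
    qed
    then have "u y = u x"
      using has_derivative_zero_unique_connected[OF G(4,3)] G(1) that by metis
    moreover have "partial_deriv i (partial_deriv i u) y = 0" for i
      by (rule partial_deriv_eq_0_of_open[OF \<open>open I\<close>])
        (use that G(2) I in \<open>auto simp: grad_eq_0_iff\<close>)
    ultimately show ?thesis by (simp add: H_def)
  qed
  \<comment> \<open>\<open>G\<close> contains \<open>x\<close> but misses the non-critical point
    given by non-triviality, so the connected set \<open>\<Omega>\<close> meets its frontier; as
    \<open>G\<close> is open, such a point lies outside \<open>G\<close>.\<close>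
  obtain p where p: "p \<in> \<Omega>" "p \<in> closure G" "p \<notin> G"
  proof -
    have "\<Omega> \<inter> frontier G \<noteq> {}"
      using \<open>connected \<Omega>\<close> assms(8) G I by (intro connected_Int_frontier) blast+
    then show ?thesis
      using that G(4) by (auto simp: frontier_def interior_open)
  qed
  \<comment> \<open>Components are relatively closed: a point of \<open>I\<close> in the closure of
    \<open>G\<close> would belong to \<open>G\<close>.\<close>
  have "p \<notin> I"
  proof
    assume "p \<in> I"
    moreover have "closedin (top_of_set I) G"
      unfolding G_def by (rule closedin_connected_component)
    ultimately show False
      using p by (auto simp: closedin_limpt closure_def)
  qed
  \<comment> \<open>Otherwise \<open>H\<close> is nonzero on a neighbourhood of \<open>p\<close>,
    which then consists of critical points and puts \<open>p\<close> in \<open>I\<close>.\<close>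
  have "H p = 0"
  proof (rule ccontr)
    assume "H p \<noteq> 0"
    let ?V = "{y \<in> \<Omega>. H y \<noteq> 0}"
    have "open ?V"
      using continuous_open_preimage[OF contH \<open>open \<Omega>\<close>, of "- {0}"]
      by (simp add: vimage_def Int_def open_Compl)
    moreover have "?V \<subseteq> {x \<in> \<Omega>. grad u x = 0}"
      using H_noncritical by auto
    ultimately have "p \<in> I"
      unfolding I_def using p \<open>H p \<noteq> 0\<close> by (intro interiorI) auto
    with \<open>p \<notin> I\<close> show False ..
  qed
  \<comment> \<open>Approaching \<open>p\<close> from within \<open>G\<close> carries the constant
    value of \<open>H\<close> there over to \<open>p\<close>.\<close>
  moreover have "H p = - f (u x)"
  proof -
    obtain g where g: "\<And>n. g n \<in> G" "g \<longlonglongrightarrow> p"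
      using p(2) unfolding closure_sequential by blast
    have "isCont H p"
      using contH \<open>open \<Omega>\<close> p(1) by (simp add: continuous_on_eq_continuous_at)
    then have "(\<lambda>n. H (g n)) \<longlonglongrightarrow> H p"
      using g(2) by (rule isCont_tendsto_compose)
    then show ?thesis
      by (simp add: HG[OF g(1)] LIMSEQ_const_iff)
  qed
  ultimately show "f (u x) = 0" by simp
qed

end
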